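(* There exists a constant $C > 0$ such that for every integer $n \ge 2$ there is a set $Q$ of at most $C\, n \log n$ permutations of $[n]$ (the queries) from which any codeword can be recovered in Static Permutation Mastermind; that is, for any two distinct permutations $\sigma \neq \tau$ of $[n]$ (codewords) there exists $q \in Q$ with $$|\{i \in [n] : q(i) = \sigma(i)\}| \;\neq\; |\{i \in [n] : q(i) = \tau(i)\}|.$$
   Context: $[n] = \{1,\dots,n\}$ and $\log$ is the natural logarithm. Static Permutation Mastermind with $n$ positions and $n$ colours: Codemaker secretly chooses a codeword, which is a permutation $\sigma$ of $[n]$ (position $i$ gets colour $\sigma(i)$, no colour repeated). Codebreaker must choose all queries in advance, before receiving any answer; each query is also a permutation $q$ of $[n]$. The answer to query $q$ is the number of black pegs, i.e. $|\{i \in [n] : q(i) = \sigma(i)\}|$. A set $Q$ of queries allows any codeword to be recovered if the codeword $\sigma$ is uniquely determined by the family of answers $\left(|\{i : q(i) = \sigma(i)\}|\right)_{q \in Q}$. *)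

theory Defs
  imports Complex_Main "HOL-Combinatorics.Permutations"
begin

(* Queries and codewords are functions p on nat with "p permutes {1..n}"; such p is the identity
   outside {1..n}, so each permutation of [n] has exactly one representative and equality of
   codewords is equality of functions. *)

definition black_pegs :: "nat \<Rightarrow> (nat \<Rightarrow> nat) \<Rightarrow> (nat \<Rightarrow> nat) \<Rightarrow> nat" where
  "black_pegs n q \<sigma> = card {i \<in> {1..n}. q i = \<sigma> i}"

definition recovers_codewords :: "nat \<Rightarrow> (nat \<Rightarrow> nat) set \<Rightarrow> bool" where
  "recovers_codewords n Q \<longleftrightarrow>
    (\<forall>\<sigma> \<tau>. \<sigma> permutes {1..n} \<longrightarrow> \<tau> permutes {1..n} \<longrightarrow> \<sigma> \<noteq> \<tau> \<longrightarrow>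
      (\<exists>q\<in>Q. black_pegs n q \<sigma> \<noteq> black_pegs n q \<tau>))"

end

theory Submission
  imports Defs
begin

text \<open>Take about \<open>64 n ln n\<close> independent uniformly random queries. If \<open>\<sigma>\<close> and \<open>\<tau>\<close> differ in \<open>d\<close> positions,
  one query separates them with probability at least \<open>d / (16 n)\<close>, and whether it does depends only on the
  \<open>d\<close> triples \<open>(i, \<sigma> i, \<tau> i)\<close> with \<open>\<sigma> i \<noteq> \<tau> i\<close>. There are at most \<open>n ^ (3 d)\<close> such sets of triples, and each of them is
  missed by all queries with probability at most \<open>n ^ (- 4 d)\<close>, so a union bound applies.

  For the probability estimate, pair the positions as \<open>{1, 2}, {3, 4}, \<dots>\<close> and write \<open>i'\<close> for the partner of \<open>i\<close>.
  If \<open>\<sigma> i \<noteq> \<tau> i\<close>, \<open>q i = \<sigma> i\<close> and \<open>q i' \<noteq> \<tau> i'\<close>, then swapping \<open>q i\<close> and \<open>q i'\<close> changes the difference of the two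
  answers, so \<open>q\<close> or the swapped query separates. By Bonferroni's inequality such an \<open>i\<close> exists with
  probability of order \<open>d / n\<close>.\<close>

section \<open>Covering by averaging\<close>

text \<open>The expectation argument without a probability space: at each stage some query leaves at
  most the average over \<open>\<Omega>\<close>. Allowing arbitrary weights is what makes the
  induction on \<open>T\<close> go through.\<close>

lemma exists_cover_weighted:
  fixes w p :: "'b \<Rightarrow> real"
  assumes "finite \<Omega>" "\<Omega> \<noteq> {}" "finite U"
    and "\<And>t. t \<in> U \<Longrightarrow> p t \<le> 1"
    and dense: "\<And>t. t \<in> U \<Longrightarrow> p t * card \<Omega> \<le> card {q \<in> \<Omega>. hits q t}"
    and "\<And>t. t \<in> U \<Longrightarrow> 0 \<le> w t"
  shows "\<exists>Q \<subseteq> \<Omega>. card Q \<le> T \<and>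
    (\<Sum>t | t \<in> U \<and> (\<forall>q\<in>Q. \<not> hits q t). w t) \<le> (\<Sum>t\<in>U. w t * (1 - p t) ^ T)"
  using assms(6)
proof (induction T arbitrary: w)
  case 0
  show ?case by (intro exI[of _ "{}"]) simp
next
  case (Suc T)
  \<comment> \<open>The factor \<open>1 - p t\<close> of the query still to be chosen goes into the
    weight, so the induction hypothesis bounds exactly what that query leaves on average.\<close>
  have "\<exists>Q \<subseteq> \<Omega>. card Q \<le> T \<and> (\<Sum>t | t \<in> U \<and> (\<forall>q\<in>Q. \<not> hits q t). w t * (1 - p t))
      \<le> (\<Sum>t\<in>U. w t * (1 - p t) * (1 - p t) ^ T)"
    using assms(4) Suc.prems by (intro Suc.IH) simp
  then obtain Q where Q: "Q \<subseteq> \<Omega>" "card Q \<le> T"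
    and le: "(\<Sum>t | t \<in> U \<and> (\<forall>q\<in>Q. \<not> hits q t). w t * (1 - p t))
      \<le> (\<Sum>t\<in>U. w t * (1 - p t) ^ Suc T)"
    by (auto simp: mult.assoc)
  define V where "V = {t \<in> U. \<forall>q\<in>Q. \<not> hits q t}"
  have fV: "finite V" using assms(3) by (simp add: V_def)
  have miss: "real (card {q \<in> \<Omega>. \<not> hits q t}) \<le> (1 - p t) * card \<Omega>" if "t \<in> U" for t
  proof -
    have "card {q \<in> \<Omega>. hits q t} + card {q \<in> \<Omega>. \<not> hits q t}
        = card ({q \<in> \<Omega>. hits q t} \<union> {q \<in> \<Omega>. \<not> hits q t})"
      by (rule card_Un_disjoint[symmetric]) (use assms(1) in auto)
    also have "{q \<in> \<Omega>. hits q t} \<union> {q \<in> \<Omega>. \<not> hits q t} = \<Omega>" by auto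
    finally show ?thesis using dense[OF that] by (simp add: algebra_simps)
  qed
  \<comment> \<open>Double counting of the pairs in which \<open>q\<close> misses \<open>t\<close>:
    each \<open>t\<close> in \<open>V\<close> is missed by at most a fraction \<open>1 - p t\<close>
    of \<open>\<Omega>\<close>.\<close>
  have "(\<Sum>q\<in>\<Omega>. \<Sum>t | t \<in> V \<and> \<not> hits q t. w t) = (\<Sum>t\<in>V. \<Sum>q | q \<in> \<Omega> \<and> \<not> hits q t. w t)"
    by (rule sum.swap_restrict[OF assms(1) fV])
  also have "\<dots> = (\<Sum>t\<in>V. w t * card {q \<in> \<Omega>. \<not> hits q t})"
    by (simp add: mult.commute)
  also have "\<dots> \<le> (\<Sum>t\<in>V. w t * ((1 - p t) * card \<Omega>))"
    using miss Suc.prems by (intro sum_mono mult_left_mono) (auto simp: V_def)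
  also have "\<dots> = of_nat (card \<Omega>) * (\<Sum>t\<in>V. w t * (1 - p t))"
    by (simp add: sum_distrib_left algebra_simps)
  finally have avg: "(\<Sum>q\<in>\<Omega>. \<Sum>t | t \<in> V \<and> \<not> hits q t. w t)
      \<le> of_nat (card \<Omega>) * (\<Sum>t\<in>V. w t * (1 - p t))" .
  obtain q where q: "q \<in> \<Omega>" "(\<Sum>t | t \<in> V \<and> \<not> hits q t. w t) \<le> (\<Sum>t\<in>V. w t * (1 - p t))"
  proof (rule ccontr)
    assume "\<not> thesis"
    then have "\<And>q. q \<in> \<Omega> \<Longrightarrow> (\<Sum>t\<in>V. w t * (1 - p t)) < (\<Sum>t | t \<in> V \<and> \<not> hits q t. w t)"
      using that by force
    then have "(\<Sum>q\<in>\<Omega>. \<Sum>t\<in>V. w t * (1 - p t)) < (\<Sum>q\<in>\<Omega>. \<Sum>t | t \<in> V \<and> \<not> hits q t. w t)"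
      using assms(1,2) by (intro sum_strict_mono) auto
    with avg show False by simp
  qed
  have "{t. t \<in> U \<and> (\<forall>q\<in>insert q Q. \<not> hits q t)} = {t. t \<in> V \<and> \<not> hits q t}"
    by (auto simp: V_def)
  moreover have "card (insert q Q) \<le> Suc T"
    using Q card_insert_le_m1[of "Suc T" Q q] by simp
  ultimately show ?case
    using q Q le by (intro exI[of _ "insert q Q"]) (auto simp: V_def)
qed

text \<open>With all weights 1, the missed weight is the number of missed targets, an integer; below
  1 it is 0.\<close>

lemma exists_cover:
  fixes p :: "'b \<Rightarrow> real"
  assumes "finite \<Omega>" "\<Omega> \<noteq> {}" "finite U"
    and "\<And>t. t \<in> U \<Longrightarrow> p t \<le> 1"
    and "\<And>t. t \<in> U \<Longrightarrow> p t * card \<Omega> \<le> card {q \<in> \<Omega>. hits q t}"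
    and small: "(\<Sum>t\<in>U. (1 - p t) ^ T) < 1"
  shows "\<exists>Q \<subseteq> \<Omega>. card Q \<le> T \<and> (\<forall>t\<in>U. \<exists>q\<in>Q. hits q t)"
proof -
  have "\<exists>Q \<subseteq> \<Omega>. card Q \<le> T \<and>
      (\<Sum>t | t \<in> U \<and> (\<forall>q\<in>Q. \<not> hits q t). 1) \<le> (\<Sum>t\<in>U. 1 * (1 - p t) ^ T)"
    by (rule exists_cover_weighted) (use assms in auto)
  then obtain Q where Q: "Q \<subseteq> \<Omega>" "card Q \<le> T"
    and "real (card {t \<in> U. \<forall>q\<in>Q. \<not> hits q t}) \<le> (\<Sum>t\<in>U. (1 - p t) ^ T)"
    by auto
  then have "real (card {t \<in> U. \<forall>q\<in>Q. \<not> hits q t}) < 1"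
    using small by simp
  then have "{t \<in> U. \<forall>q\<in>Q. \<not> hits q t} = {}"
    using assms(3) by simp
  with Q show ?thesis by blast
qed

section \<open>Counting subsets, permutations and unions\<close>

lemma sum_power_card_Pow:
  fixes x :: "'a :: comm_semiring_1"
  assumes "finite A"
  shows "(\<Sum>X\<in>Pow A. x ^ card X) = (x + 1) ^ card A"
  using prod_add[OF assms, of "\<lambda>_. x" "\<lambda>_. 1"] by simp

lemma permutes_differ_in:
  assumes "p permutes S" "q permutes S" "p x \<noteq> q x"
  shows "x \<in> S"
  using assms permutes_not_in by metis

text \<open>Left composition with \<open>inv p\<close> turns the prescribed values into fixed points
  and leaves a permutation of \<open>S - I\<close>.\<close>

lemma card_permutes_agreeing:
  assumes "finite S" "I \<subseteq> S" "p permutes S"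
  shows "card {q. q permutes S \<and> (\<forall>i\<in>I. q i = p i)} = fact (card S - card I)"
proof -
  have "{q. q permutes S \<and> (\<forall>i\<in>I. q i = p i)} = (\<lambda>r. p \<circ> r) ` {r. r permutes (S - I)}"
  proof (intro equalityI subsetI)
    fix q assume q: "q \<in> {q. q permutes S \<and> (\<forall>i\<in>I. q i = p i)}"
    have "inv p \<circ> q permutes S"
      using q assms by (auto intro: permutes_compose permutes_inv)
    moreover have "(inv p \<circ> q) i = i" if "i \<in> I" for i
      using that q permutes_inverses(2)[OF assms(3)] by simp
    ultimately have "inv p \<circ> q permutes (S - I)"
      by (rule permutes_superset) auto
    moreover have "q = p \<circ> (inv p \<circ> q)"
      using permutes_inv_o(1)[OF assms(3)] by (simp add: o_assoc)
    ultimately show "q \<in> (\<lambda>r. p \<circ> r) ` {r. r permutes (S - I)}" by blast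
  next
    fix q assume "q \<in> (\<lambda>r. p \<circ> r) ` {r. r permutes (S - I)}"
    then obtain r where r: "r permutes (S - I)" "q = p \<circ> r" by blast
    then have "r permutes S" by (auto intro: permutes_subset)
    then show "q \<in> {q. q permutes S \<and> (\<forall>i\<in>I. q i = p i)}"
      using r assms by (auto intro: permutes_compose simp: permutes_not_in[OF r(1)])
  qed
  moreover have "inj_on (\<lambda>r. p \<circ> r) {r. r permutes (S - I)}"
    using permutes_inj[OF assms(3)] by (auto intro!: inj_onI simp: fun_eq_iff inj_eq)
  ultimately have "card {q. q permutes S \<and> (\<forall>i\<in>I. q i = p i)} = card {r. r permutes (S - I)}"
    by (simp add: card_image)
  also have "\<dots> = fact (card S - card I)"
    using assms by (intro card_permutations) (auto simp: card_Diff_subset finite_subset[OF assms(2)])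
  finally show ?thesis .
qed

text \<open>Equality can fail: if \<open>a = b\<close>, or if one of them lies outside
  \<open>S\<close>, there is no such permutation.\<close>

lemma card_permutes_two_values_le:
  assumes "finite S" "i \<in> S" "j \<in> S" "i \<noteq> j"
  shows "card {q. q permutes S \<and> q i = a \<and> q j = b} \<le> fact (card S - 2)"
proof (cases "\<exists>p. p permutes S \<and> p i = a \<and> p j = b")
  case True
  then obtain p where "p permutes S" "p i = a" "p j = b" by blast
  then show ?thesis
    using card_permutes_agreeing[of S "{i, j}" p] assms by (simp add: numeral_2_eq_2)
next
  case False
  then have "{q. q permutes S \<and> q i = a \<and> q j = b} = {}" by blast
  then show ?thesis by (metis card.empty le0)
qed

text \<open>Inclusion-exclusion cut off after pairwise intersections: each new set loses at most its
  overlaps with the earlier ones, \<open>b\<close> apiece.\<close>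

lemma card_UN_ge_Bonferroni:
  fixes a b :: real
  assumes "finite M" "\<And>i. i \<in> M \<Longrightarrow> finite (A i)"
    and "\<And>i. i \<in> M \<Longrightarrow> a \<le> card (A i)"
    and "\<And>i j. i \<in> M \<Longrightarrow> j \<in> M \<Longrightarrow> i \<noteq> j \<Longrightarrow> card (A i \<inter> A j) \<le> b"
  shows "card M * a - real (card M) * (real (card M) - 1) / 2 * b \<le> card (\<Union>i\<in>M. A i)"
  using assms
proof (induction M rule: finite_induct)
  case empty
  show ?case by simp
next
  case (insert x F)
  let ?B = "\<Union>i\<in>F. A i"
  have IH: "card F * a - real (card F) * (real (card F) - 1) / 2 * b \<le> card ?B"
    by (rule insert.IH) (use insert.prems in auto)
  have "card (A x \<inter> ?B) \<le> (\<Sum>i\<in>F. card (A x \<inter> A i))"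
    using card_UN_le[OF insert.hyps(1), of "\<lambda>i. A x \<inter> A i"] by simp
  then have "real (card (A x \<inter> ?B)) \<le> (\<Sum>i\<in>F. real (card (A x \<inter> A i)))"
    by (metis of_nat_le_iff of_nat_sum)
  also have "\<dots> \<le> (\<Sum>i\<in>F. b)"
    by (rule sum_mono) (use insert in auto)
  finally have int: "real (card (A x \<inter> ?B)) \<le> card F * b" by simp
  have "card (A x) + card ?B = card (A x \<union> ?B) + card (A x \<inter> ?B)"
    by (rule card_Un_Int) (use insert in auto)
  then have "real (card (A x \<union> ?B)) = card (A x) + card ?B - card (A x \<inter> ?B)"
    by linarith
  moreover have "a \<le> card (A x)" using insert.prems by auto
  ultimately have "card F * a - real (card F) * (real (card F) - 1) / 2 * b + a - card F * b \<le> card (A x \<union> ?B)"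
    using IH int by linarith
  also have "card F * a - real (card F) * (real (card F) - 1) / 2 * b + a - card F * b
      = (real (card F) + 1) * a - (real (card F) + 1) * (real (card F) + 1 - 1) / 2 * b"
    by (simp add: algebra_simps add_divide_distrib diff_divide_distrib)
  finally show ?case
    using insert.hyps by (simp add: add.commute)
qed

section \<open>Swaps inside pairs of positions\<close>

text \<open>The pairs are {1, 2}, {3, 4} and so on; truncated subtraction makes 0 a fixed point, so
  the identity holds on all of \<open>nat\<close>.\<close>

lemma even_odd_swap_involution:
  fixes i :: nat
  defines "h \<equiv> \<lambda>i. if even i then i - 1 else i + 1"
  shows "h (h i) = i"
  by (cases "i = 0") (auto simp: h_def)

text \<open>If swapping the values of \<open>q\<close> at \<open>i\<close> and \<open>h i\<close> changes \<open>\<Sum>i\<in>S. f i (q i)\<close>, then the sum is nonzero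
  for one of the two permutations. Whether a pair is sensitive in this sense is not affected by swaps
  inside pairs, so swapping the least sensitive pair is an involution.\<close>

lemma card_sensitive_le:
  fixes f :: "nat \<Rightarrow> nat \<Rightarrow> int"
  assumes S: "finite S" and hh: "\<And>i. h (h i) = i"
  defines "sens \<equiv> \<lambda>q i. i \<in> S \<and> h i \<in> S \<and> f i (q i) + f (h i) (q (h i)) \<noteq> f i (q (h i)) + f (h i) (q i)"
  shows "card {q. q permutes S \<and> (\<exists>i. sens q i)} \<le> 2 * card {q. q permutes S \<and> (\<Sum>i\<in>S. f i (q i)) \<noteq> 0}"
proof -
  define A where "A = {q. q permutes S \<and> (\<exists>i. sens q i)}"
  define G where "G = {q. q permutes S \<and> (\<Sum>i\<in>S. f i (q i)) \<noteq> 0}"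
  define \<phi> where "\<phi> q = (let k = LEAST i. sens q i in q \<circ> transpose k (h k))" for q
  have fin: "finite A" "finite G"
    using finite_permutations[OF S] by (auto simp: A_def G_def)
  have sens_swap: "sens (q \<circ> transpose k (h k)) = sens q" for q k
  proof
    fix i
    consider "i = k" | "i = h k" | "i \<noteq> k" "i \<noteq> h k" "h i \<noteq> k" "h i \<noteq> h k"
      using hh by metis
    then show "sens (q \<circ> transpose k (h k)) i = sens q i"
      by cases (auto simp: sens_def hh transpose_def)
  qed
  \<comment> \<open>The chosen index depends on \<open>q\<close> only through \<open>sens q\<close>,
    so both applications swap the same pair, even if no index is sensitive.\<close>
  have \<phi>\<phi>: "\<phi> (\<phi> q) = q" for q
    by (simp add: \<phi>_def Let_def sens_swap o_assoc[symmetric])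
  have change: "\<phi> q permutes S \<and> (\<Sum>i\<in>S. f i (\<phi> q i)) \<noteq> (\<Sum>i\<in>S. f i (q i))" if "q \<in> A" for q
  proof -
    define k where "k = (LEAST i. sens q i)"
    have k: "sens q k" unfolding k_def using that by (auto simp: A_def intro: LeastI)
    \<comment> \<open>If \<open>h k = k\<close>, both sides of the inequality in \<open>sens\<close>
      would coincide.\<close>
    then have kS: "k \<in> S" "h k \<in> S" "h k \<noteq> k" by (auto simp: sens_def)
    have \<phi>: "\<phi> q = q \<circ> transpose k (h k)" by (simp add: \<phi>_def k_def Let_def)
    have split: "(\<Sum>i\<in>S. g i) = g k + (g (h k) + (\<Sum>i\<in>S - {k} - {h k}. g i))" for g :: "nat \<Rightarrow> int"
      using kS S by (simp add: sum.remove[of S k] sum.remove[of "S - {k}" "h k"])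
    have "(\<Sum>i\<in>S - {k} - {h k}. f i (\<phi> q i)) = (\<Sum>i\<in>S - {k} - {h k}. f i (q i))"
      by (rule sum.cong) (auto simp: \<phi> transpose_def)
    then have "(\<Sum>i\<in>S. f i (\<phi> q i)) \<noteq> (\<Sum>i\<in>S. f i (q i))"
      using k by (simp add: split sens_def \<phi>)
    moreover have "\<phi> q permutes S"
      using that kS by (auto simp: \<phi> A_def intro: permutes_compose permutes_swap_id)
    ultimately show ?thesis by simp
  qed
  have "A \<subseteq> G \<union> \<phi> ` G"
  proof
    fix q assume "q \<in> A"
    then have "q \<in> G \<or> \<phi> q \<in> G"
      using change[of q] by (auto simp: A_def G_def)
    then show "q \<in> G \<union> \<phi> ` G" using \<phi>\<phi> by (metis UnCI imageI)
  qed
  then have "card A \<le> card (G \<union> \<phi> ` G)"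
    using fin by (intro card_mono) auto
  also have "\<dots> \<le> card G + card (\<phi> ` G)" by (rule card_Un_le)
  also have "\<dots> \<le> 2 * card G" using card_image_le[OF fin(2), of \<phi>] by simp
  finally show ?thesis by (simp add: A_def G_def)
qed

section \<open>Differences of codewords as sets of triples\<close>

definition peg_diff :: "(nat \<times> nat \<times> nat) set \<Rightarrow> (nat \<Rightarrow> nat) \<Rightarrow> int" where
  "peg_diff G q = (\<Sum>(i, a, b)\<in>G. of_bool (q i = a) - of_bool (q i = b))"

text \<open>Positions of agreement contribute nothing to the difference of the answers. Leaving them
  out makes the number of possible sets depend on \<open>d\<close>, which the union bound
  needs.\<close>

definition diff_graph :: "nat \<Rightarrow> (nat \<Rightarrow> nat) \<Rightarrow> (nat \<Rightarrow> nat) \<Rightarrow> (nat \<times> nat \<times> nat) set" where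
  "diff_graph n \<sigma> \<tau> = (\<lambda>i. (i, \<sigma> i, \<tau> i)) ` {i \<in> {1..n}. \<sigma> i \<noteq> \<tau> i}"

lemma card_diff_graph: "card (diff_graph n \<sigma> \<tau>) = card {i \<in> {1..n}. \<sigma> i \<noteq> \<tau> i}"
  unfolding diff_graph_def by (intro card_image inj_onI) simp

lemma peg_diff_diff_graph_eq_sum:
  "peg_diff (diff_graph n \<sigma> \<tau>) q = (\<Sum>i\<in>{1..n}. of_bool (q i = \<sigma> i) - of_bool (q i = \<tau> i))"
proof -
  have "peg_diff (diff_graph n \<sigma> \<tau>) q
      = (\<Sum>i | i \<in> {1..n} \<and> \<sigma> i \<noteq> \<tau> i. of_bool (q i = \<sigma> i) - of_bool (q i = \<tau> i))"
    unfolding peg_diff_def diff_graph_def by (subst sum.reindex) (auto intro: inj_onI)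
  also have "\<dots> = (\<Sum>i\<in>{1..n}. of_bool (q i = \<sigma> i) - of_bool (q i = \<tau> i))"
    by (rule sum.mono_neutral_left) auto
  finally show ?thesis .
qed

lemma peg_diff_diff_graph:
  "peg_diff (diff_graph n \<sigma> \<tau>) q = int (black_pegs n q \<sigma>) - int (black_pegs n q \<tau>)"
proof -
  have "int (black_pegs n q \<rho>) = (\<Sum>i\<in>{1..n}. of_bool (q i = \<rho> i))" for \<rho>
    by (simp add: black_pegs_def sum.If_cases of_bool_def Int_def)
  then show ?thesis by (simp add: peg_diff_diff_graph_eq_sum sum_subtractf)
qed

section \<open>The probability that one query separates\<close>

text \<open>For \<open>n \<ge> 3\<close> the constant 16 is a product of four factors 2: from
  Bonferroni, from the swap, from \<open>n - 2 \<ge> (n - 1) / 2\<close>, and from discarding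
  position \<open>n\<close>.\<close>

lemma card_separating_permutes_ge:
  assumes "n \<ge> 2" and \<sigma>: "\<sigma> permutes {1..n}" and \<tau>: "\<tau> permutes {1..n}" and "\<sigma> \<noteq> \<tau>"
  shows "card (diff_graph n \<sigma> \<tau>) / (16 * n) * card {q. q permutes {1..n}}
    \<le> card {q \<in> {q. q permutes {1..n}}. peg_diff (diff_graph n \<sigma> \<tau>) q \<noteq> 0}"
proof -
  define D where "D = {i \<in> {1..n}. \<sigma> i \<noteq> \<tau> i}"
  define G where "G = {q. q permutes {1..n} \<and> peg_diff (diff_graph n \<sigma> \<tau>) q \<noteq> 0}"
  have card_perm: "card {q. q permutes {1..n}} = fact n"
    by (rule card_permutations) auto
  have finG: "finite G" using finite_permutations[of "{1..n}"] by (auto simp: G_def)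
  have dn: "card D \<le> n" using card_mono[of "{1..n}" D] unfolding D_def by fastforce
  obtain k where k: "\<sigma> k \<noteq> \<tau> k" using \<open>\<sigma> \<noteq> \<tau>\<close> by auto
  \<comment> \<open>Distinct permutations never differ in just one place: the position where
    \<sigma> takes the value \<open>\<tau> k\<close> is a second one.\<close>
  define l where "l = inv \<sigma> (\<tau> k)"
  have l: "\<sigma> l = \<tau> k" using permutes_inverses(1)[OF \<sigma>] by (simp add: l_def)
  then have "l \<noteq> k" using k by metis
  then have "\<sigma> l \<noteq> \<tau> l" using l permutes_inj[OF \<tau>] by (simp add: inj_eq)
  then have D2: "l \<in> D" "k \<in> D"
    using k permutes_differ_in[OF \<sigma> \<tau>] by (simp_all add: D_def del: atLeastAtMost_iff)
  have finD: "finite D" by (simp add: D_def)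
  have two: "2 \<le> card D"
    using card_mono[OF finD, of "{l, k}"] D2 \<open>l \<noteq> k\<close> by simp
  have "card D / (16 * n) * fact n \<le> card G"
  proof (cases "n = 2")
    \<comment> \<open>The general estimate has a factor \<open>n - 2\<close> and is void here, but
      \<sigma> itself is a separating query, and one suffices.\<close>
    case True
    have "peg_diff (diff_graph n \<sigma> \<tau>) \<sigma> = (\<Sum>i\<in>{1..n}. 1 - of_bool (\<sigma> i = \<tau> i))"
      by (simp add: peg_diff_diff_graph_eq_sum)
    also have "\<dots> = (\<Sum>i\<in>D. 1)"
      by (rule sum.mono_neutral_cong_right) (auto simp: D_def)
    finally have "\<sigma> \<in> G" using \<sigma> two by (simp add: G_def)
    then have "card G \<noteq> 0" using finG by auto
    moreover have "real (card D) / (16 * n) * fact n \<le> 1"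
      using True dn by simp
    ultimately show ?thesis by linarith
  next
    case False
    with assms(1) have n3: "n \<ge> 3" by simp
    define F :: real where "F = fact (n - 2)"
    have factn: "fact n = real n * (real n - 1) * F"
      using assms(1) fact_reduce[of n, where 'a = real] fact_reduce[of "n - 1", where 'a = real]
      by (simp add: F_def numeral_2_eq_2 of_nat_diff)
    have factn1: "fact (n - 1) = (real n - 1) * F"
      using assms(1) fact_reduce[of "n - 1", where 'a = real]
      by (simp add: F_def numeral_2_eq_2 of_nat_diff)
    have F: "F > 0" by (simp add: F_def)
    define h where "h = (\<lambda>i::nat. if even i then i - 1 else i + 1)"
    define f where "f i c = (of_bool (c = \<sigma> i) - of_bool (c = \<tau> i) :: int)" for i c
    \<comment> \<open>For odd \<open>n\<close> the partner of \<open>n\<close> would be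
      \<open>n + 1\<close>. Since \<open>2 \<le> card D\<close>, at least half of \<open>D\<close>
      remains, and \<open>card M \<le> n - 1\<close> keeps the Bonferroni correction small.\<close>
    define M where "M = D - {n}"
    define A where "A i = {q. q permutes {1..n} \<and> q i = \<sigma> i \<and> q (h i) \<noteq> \<tau> (h i)}" for i
    have M: "i \<in> {1..n}" "h i \<in> {1..n}" "h i \<noteq> i" "\<sigma> i \<noteq> \<tau> i" if "i \<in> M" for i
      using that by (auto simp: M_def D_def h_def elim!: oddE evenE)
    have finM: "finite M" using finD by (simp add: M_def)
    have cM: "real (card D) / 2 \<le> card M" "real (card M) \<le> real n - 1"
    proof -
      show "real (card D) / 2 \<le> card M"
        using two finD by (cases "n \<in> D") (auto simp: M_def)
      have "card M \<le> card ({1..n} - {n})" by (intro card_mono) (auto simp: M_def D_def)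
      then show "real (card M) \<le> real n - 1" using assms(1) by (simp add: of_nat_diff)
    qed
    have finA: "finite (A i)" for i
      using finite_permutations[of "{1..n}"] by (auto simp: A_def)
    have cardA: "(real n - 2) * F \<le> card (A i)" if i: "i \<in> M" for i
    proof -
      let ?B = "{q. q permutes {1..n} \<and> q i = \<sigma> i}"
      let ?C = "{q. q permutes {1..n} \<and> q i = \<sigma> i \<and> q (h i) = \<tau> (h i)}"
      have finB: "finite ?B" using finite_permutations[of "{1..n}"] by auto
      have "card ?B = fact (n - 1)"
        using card_permutes_agreeing[of "{1..n}" "{i}" \<sigma>] M[OF i] \<sigma> by simp
      moreover have "card ?C \<le> fact (n - 2)"
        using card_permutes_two_values_le[of "{1..n}" i "h i" "\<sigma> i" "\<tau> (h i)"] M[OF i] by simp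
      moreover have "?B - ?C = A i" by (auto simp: A_def)
      moreover have "card (?B - ?C) = card ?B - card ?C"
        by (rule card_Diff_subset) (auto intro: finite_subset[OF _ finB])
      ultimately have "(fact (n - 1) :: nat) \<le> card (A i) + fact (n - 2)" by simp
      then have "(fact (n - 1) :: real) \<le> card (A i) + F"
        unfolding F_def by (metis of_nat_add of_nat_fact of_nat_le_iff)
      then show ?thesis unfolding factn1 by (simp add: algebra_simps)
    qed
    have cardAA: "real (card (A i \<inter> A j)) \<le> F" if "i \<in> M" "j \<in> M" "i \<noteq> j" for i j
    proof -
      have "card (A i \<inter> A j) \<le> card {q. q permutes {1..n} \<and> q i = \<sigma> i \<and> q j = \<sigma> j}"
        using finite_permutations[of "{1..n}"] by (intro card_mono) (auto simp: A_def)
      also have "\<dots> \<le> fact (n - 2)"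
        using card_permutes_two_values_le[of "{1..n}" i j "\<sigma> i" "\<sigma> j"] M that by simp
      finally show ?thesis unfolding F_def by (metis of_nat_fact of_nat_le_iff)
    qed
    have "(\<Union>i\<in>M. A i) \<subseteq> {q. q permutes {1..n} \<and> (\<exists>i. i \<in> {1..n} \<and> h i \<in> {1..n} \<and>
        f i (q i) + f (h i) (q (h i)) \<noteq> f i (q (h i)) + f (h i) (q i))}"
    proof
      fix q assume "q \<in> (\<Union>i\<in>M. A i)"
      then obtain i where i: "i \<in> M" and q: "q permutes {1..n}" "q i = \<sigma> i" "q (h i) \<noteq> \<tau> (h i)"
        by (auto simp: A_def)
      have "q (h i) \<noteq> \<sigma> i" "\<sigma> (h i) \<noteq> \<sigma> i"
        using q M[OF i] permutes_inj[OF q(1)] permutes_inj[OF \<sigma>] by (metis injD)+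
      \<comment> \<open>The left side is at least 1: its first term is 1 and its second is not
        negative. On the right neither value can match \<sigma>, so both terms are at most
        0.\<close>
      then have "f i (q i) + f (h i) (q (h i)) \<noteq> f i (q (h i)) + f (h i) (q i)"
        using q M(4)[OF i] by (auto simp: f_def of_bool_def)
      then show "q \<in> {q. q permutes {1..n} \<and> (\<exists>i. i \<in> {1..n} \<and> h i \<in> {1..n} \<and>
          f i (q i) + f (h i) (q (h i)) \<noteq> f i (q (h i)) + f (h i) (q i))}"
        using M[OF i] q by blast
    qed
    then have "card (\<Union>i\<in>M. A i) \<le> card {q. q permutes {1..n} \<and> (\<exists>i. i \<in> {1..n} \<and> h i \<in> {1..n} \<and>
        f i (q i) + f (h i) (q (h i)) \<noteq> f i (q (h i)) + f (h i) (q i))}"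
      using finite_permutations[of "{1..n}"] by (intro card_mono) auto
    also have "\<dots> \<le> 2 * card {q. q permutes {1..n} \<and> (\<Sum>i\<in>{1..n}. f i (q i)) \<noteq> 0}"
      by (rule card_sensitive_le) (simp_all add: h_def even_odd_swap_involution)
    also have "{q. q permutes {1..n} \<and> (\<Sum>i\<in>{1..n}. f i (q i)) \<noteq> 0} = G"
      by (simp add: G_def f_def peg_diff_diff_graph_eq_sum)
    finally have AG: "real (card (\<Union>i\<in>M. A i)) \<le> 2 * card G" by linarith
    let ?m = "real (card M)" and ?n = "real n"
    have "?m * ((?n - 2) * F) - ?m * (?m - 1) / 2 * F \<le> card (\<Union>i\<in>M. A i)"
      by (rule card_UN_ge_Bonferroni) (use finM finA cardA cardAA in auto)
    \<comment> \<open>As \<open>?m - 1 \<le> ?n - 2\<close>, the correction eats at most half of the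
      main term.\<close>
    moreover have "?m * (?m - 1) / 2 * F \<le> ?m * (?n - 2) / 2 * F"
      using cM F by (intro mult_right_mono divide_right_mono mult_left_mono) auto
    moreover have "?m * ((?n - 2) * F) = ?m * (?n - 2) / 2 * F + ?m * (?n - 2) / 2 * F"
      by simp
    ultimately have "?m * (?n - 2) / 2 * F \<le> 2 * card G"
      using AG by linarith
    moreover have "?m * ((?n - 1) / 2) / 2 * F \<le> ?m * (?n - 2) / 2 * F"
      using n3 F by (intro mult_right_mono divide_right_mono mult_left_mono) auto
    moreover have "card D / 2 * ((?n - 1) / 2) / 2 * F \<le> ?m * ((?n - 1) / 2) / 2 * F"
      using cM(1) F assms(1) by (intro mult_right_mono divide_right_mono) auto
    moreover have "card D / (16 * n) * fact n = card D / 2 * ((?n - 1) / 2) / 2 * F / 2"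
      unfolding factn using assms(1) by simp
    ultimately show ?thesis by linarith
  qed
  then show ?thesis
    using card_perm by (simp add: card_diff_graph D_def G_def)
qed

section \<open>The union bound over sets of triples\<close>

theorem theorem1p1:
  shows "\<exists>C::real. C > 0 \<and>
    (\<forall>n::nat. n \<ge> 2 \<longrightarrow>
      (\<exists>Q::(nat \<Rightarrow> nat) set.
        Q \<subseteq> {q. q permutes {1..n}} \<and>
        real (card Q) \<le> C * real n * ln (real n) \<and>
        recovers_codewords n Q))"
proof (intro exI[of _ "65::real"] conjI allI impI)
  fix n :: nat
  assume n: "n \<ge> 2"
  define \<Omega> where "\<Omega> = {q. q permutes {1..n}}"
  define B where "B = {1..n} \<times> {1..n} \<times> {1..n}"
  define U where "U = {diff_graph n \<sigma> \<tau> | \<sigma> \<tau>. \<sigma> permutes {1..n} \<and> \<tau> permutes {1..n} \<and> \<sigma> \<noteq> \<tau>}"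
  define p where "p G = real (card G) / (16 * n)" for G :: "(nat \<times> nat \<times> nat) set"
  \<comment> \<open>64 = 16 * 4: the 16 cancels the denominator of \<open>p\<close>, and the 4
    yields a miss bound of \<open>n ^ (- 4 d)\<close> for a set of \<open>d\<close> triples.\<close>
  define T where "T = nat \<lceil>64 * real n * ln (real n)\<rceil>"
  define x where "x = 1 / real n ^ 4"
  have "finite B" by (simp add: B_def)
  have cardB: "card B = n ^ 3" by (simp add: B_def power3_eq_cube)
  have \<Omega>: "finite \<Omega>" "\<Omega> \<noteq> {}"
    using finite_permutations[of "{1..n}"] permutes_id[of "{1..n}"] unfolding \<Omega>_def by blast+
  have cover: "p G \<le> 1 \<and> p G * card \<Omega> \<le> card {q \<in> \<Omega>. peg_diff G q \<noteq> 0} \<and> G \<in> Pow B - {{}}"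
    if GU: "G \<in> U" for G
  proof -
    obtain \<sigma> \<tau> where st: "\<sigma> permutes {1..n}" "\<tau> permutes {1..n}" "\<sigma> \<noteq> \<tau>"
      and G: "G = diff_graph n \<sigma> \<tau>"
      using GU unfolding U_def by blast
    have "card G \<le> n"
      using card_mono[of "{1..n}" "{i \<in> {1..n}. \<sigma> i \<noteq> \<tau> i}"] unfolding G card_diff_graph by fastforce
    then have "p G \<le> 1" using n by (simp add: p_def)
    moreover have "G \<subseteq> B"
      unfolding G B_def diff_graph_def using permutes_in_image[OF st(1)] permutes_in_image[OF st(2)]
      by (auto simp del: atLeastAtMost_iff)
    moreover have "G \<noteq> {}"
    proof -
      obtain k where k: "\<sigma> k \<noteq> \<tau> k" using st(3) by auto
      with permutes_differ_in[OF st(1,2)] show ?thesis by (auto simp: G diff_graph_def)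
    qed
    ultimately show ?thesis
      using card_separating_permutes_ge[OF n st] by (simp add: p_def \<Omega>_def G)
  qed
  have finU: "finite U"
    using cover \<open>finite B\<close> by (meson DiffD1 finite_Pow_iff finite_subset subsetI)
  \<comment> \<open>Serves twice: for \<open>ln n \<ge> 1 / 2\<close>, and for the final bound
    \<open>exp (1 / 2) - 1 < 1\<close>.\<close>
  have exp_half: "exp (1 / 2 :: real) < 2"
  proof (rule power2_less_imp_less)
    have "(exp (1 / 2 :: real))\<^sup>2 = exp 1" by (simp flip: exp_of_nat_mult)
    then show "(exp (1 / 2 :: real))\<^sup>2 < 2\<^sup>2" using exp_le by simp
  qed simp
  have lnn: "1 / 2 \<le> ln (real n)"
    using n exp_half by (subst ln_ge_iff) auto
  \<comment> \<open>Rounding up costs at most 1, which is at most \<open>n * ln n\<close>; hence 65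
    instead of 64.\<close>
  have T: "64 * real n * ln (real n) \<le> T" "T \<le> 65 * real n * ln (real n)"
  proof -
    show "64 * real n * ln (real n) \<le> T" unfolding T_def by linarith
    have "1 \<le> real n * ln (real n)" using mult_mono[of 2 "real n" "1/2" "ln (real n)"] n lnn by simp
    moreover have "real T \<le> 64 * real n * ln (real n) + 1"
      using lnn unfolding T_def by simp
    ultimately show "T \<le> 65 * real n * ln (real n)" by simp
  qed
  have miss: "(1 - p G) ^ T \<le> x ^ card G" if "G \<in> U" for G
  proof -
    have "(1 - p G) ^ T \<le> exp (- p G) ^ T"
      using exp_ge_add_one_self[of "- p G"] cover[OF that] by (intro power_mono) auto
    also have "\<dots> = exp (- (T * p G))" by (simp add: exp_of_nat_mult[symmetric])
    also have "\<dots> \<le> exp (- (64 * real n * ln (real n) * p G))"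
      using mult_right_mono[OF T(1), of "p G"] by (simp add: p_def)
    also have "64 * real n * ln (real n) * p G = card G * (4 * ln (real n))"
      using n by (simp add: p_def)
    also have "exp (- (card G * (4 * ln (real n)))) = x ^ card G"
    proof -
      have "x = exp (- (4 * ln (real n)))"
        using n exp_of_nat_mult[of 4 "ln (real n)"] by (simp add: x_def exp_minus inverse_eq_divide)
      then show ?thesis by (simp add: exp_of_nat_mult[symmetric])
    qed
    finally show ?thesis .
  qed
  have "(\<Sum>G\<in>U. (1 - p G) ^ T) \<le> (\<Sum>G\<in>U. x ^ card G)"
    by (rule sum_mono) (rule miss)
  \<comment> \<open>Summing over all nonempty sets of triples gives a closed form. Excluding the
    empty set is essential, as its term alone is 1.\<close>
  also have "\<dots> \<le> (\<Sum>G\<in>Pow B - {{}}. x ^ card G)"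
    using cover \<open>finite B\<close> by (intro sum_mono2) (auto simp: x_def)
  also have "\<dots> = (x + 1) ^ (n ^ 3) - 1"
    using \<open>finite B\<close> by (simp add: sum_diff1 sum_power_card_Pow cardB)
  also have "\<dots> \<le> exp (1 / 2) - 1"
  proof -
    have "(x + 1) ^ (n ^ 3) \<le> exp x ^ (n ^ 3)"
      using exp_ge_add_one_self[of x] by (intro power_mono) (auto simp: x_def add.commute)
    also have "\<dots> = exp (real n ^ 3 * x)" by (simp flip: exp_of_nat_mult)
    also have "\<dots> \<le> exp (1 / 2)"
    proof -
      have "real n ^ 3 * x = 1 / real n"
        using n by (simp add: x_def field_simps power3_eq_cube power4_eq_xxxx)
      also have "\<dots> \<le> 1 / 2" using n by simp
      finally show ?thesis by simp
    qed
    finally show ?thesis by simp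
  qed
  also have "\<dots> < 1" using exp_half by simp
  finally have "(\<Sum>G\<in>U. (1 - p G) ^ T) < 1" .
  then have "\<exists>Q \<subseteq> \<Omega>. card Q \<le> T \<and> (\<forall>G\<in>U. \<exists>q\<in>Q. peg_diff G q \<noteq> 0)"
    using \<Omega> finU cover by (intro exists_cover[where p = p and hits = "\<lambda>q G. peg_diff G q \<noteq> 0"]) blast+
  then obtain Q where Q: "Q \<subseteq> \<Omega>" "card Q \<le> T" "\<forall>G\<in>U. \<exists>q\<in>Q. peg_diff G q \<noteq> 0"
    by blast
  have "recovers_codewords n Q"
    unfolding recovers_codewords_def
  proof (intro allI impI)
    fix \<sigma> \<tau> assume "\<sigma> permutes {1..n}" "\<tau> permutes {1..n}" "\<sigma> \<noteq> \<tau>"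
    then have "diff_graph n \<sigma> \<tau> \<in> U" by (auto simp: U_def)
    with Q(3) show "\<exists>q\<in>Q. black_pegs n q \<sigma> \<noteq> black_pegs n q \<tau>"
      by (fastforce simp: peg_diff_diff_graph)
  qed
  moreover have "real (card Q) \<le> 65 * real n * ln (real n)"
    using Q(2) T(2) by linarith
  ultimately show "\<exists>Q. Q \<subseteq> {q. q permutes {1..n}} \<and>
      real (card Q) \<le> 65 * real n * ln (real n) \<and> recovers_codewords n Q"
    using Q(1) by (auto simp: \<Omega>_def)
qed simp

end
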